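(* There is a set $A \subseteq \mathbb{Z}$ whose consecutive elements differ by at most $2$ such that $H(A^d) = \infty$ for every integer $d \geq 2$.
   Context: $A^d \subseteq \mathbb{R}^d$ denotes the $d$-fold Cartesian product of $A$. For $S \subseteq \mathbb{R}^d$, $H(S)$ denotes the least integer $h$, if it exists, such that for every finite family $\mathcal F$ of convex sets in $\mathbb{R}^d$: if the intersection of any $h$ or fewer members of $\mathcal F$ contains a point of $S$, then $\bigcap \mathcal F$ contains a point of $S$. If no such integer exists, $H(S) = \infty$. *)

theory Defs
  imports Complex_Main "HOL-Library.Extended_Nat" "Jordan_Normal_Form.Matrix"
begin

text \<open>
  The dimension varies inside the statement, so \<open>\<real>\<^sup>d\<close> is rendered as the carrier
  \<^term>\<open>carrier_vec d :: real vec set\<close> rather than as a type. The type of vectors of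
  arbitrary length is not a \<open>real_vector\<close>, so the library's \<open>convex\<close> does not apply;
  the definition below is the same condition relative to the carrier.
\<close>

definition convex_vec :: "nat \<Rightarrow> real vec set \<Rightarrow> bool" where
  "convex_vec d C \<longleftrightarrow> C \<subseteq> carrier_vec d \<and>
     (\<forall>x\<in>C. \<forall>y\<in>C. \<forall>u\<ge>0. \<forall>v\<ge>0. u + v = 1 \<longrightarrow> u \<cdot>\<^sub>v x + v \<cdot>\<^sub>v y \<in> C)"

definition cart_power :: "real set \<Rightarrow> nat \<Rightarrow> real vec set" where
  "cart_power A d = {x \<in> carrier_vec d. \<forall>i<d. x $ i \<in> A}"

text \<open>
  Intersections are taken inside \<open>\<real>\<^sup>d\<close>, so the intersection of the empty family is \<open>\<real>\<^sup>d\<close>.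
\<close>

definition helly_property :: "nat \<Rightarrow> real vec set \<Rightarrow> nat \<Rightarrow> bool" where
  "helly_property d S h \<longleftrightarrow>
     (\<forall>F. finite F \<and> (\<forall>C\<in>F. convex_vec d C) \<and>
        (\<forall>G\<subseteq>F. card G \<le> h \<longrightarrow> (carrier_vec d \<inter> \<Inter>G) \<inter> S \<noteq> {}) \<longrightarrow>
        (carrier_vec d \<inter> \<Inter>F) \<inter> S \<noteq> {})"

definition helly_number :: "nat \<Rightarrow> real vec set \<Rightarrow> enat" where
  "helly_number d S =
     (if \<exists>h. helly_property d S h then enat (LEAST h. helly_property d S h) else \<infinity>)"

end

theory Submission
  imports Defs "HOL-Number_Theory.Fib"
begin

text \<open>
  Let \<open>\<phi>\<close> be the golden ratio and let \<open>A\<close> consist of the numbers \<open>-2i\<close>, \<open>\<lceil>\<phi> i\<rceil>\<close> and the even-indexed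
  Fibonacci numbers. In the plane, put \<open>x = -p\<^sub>0/2\<close> and \<open>y = p\<^sub>1\<close>, so that every natural number occurs
  as an \<open>x\<close>. The strip \<open>0 < \<phi> x - y \<le> 1/\<phi>\<close>, \<open>y > 0\<close> contains no point with \<open>y = \<lceil>\<phi> j\<rceil>\<close>, and its
  points in \<open>A\<^sup>2\<close> are exactly the pairs \<open>(x, y) = (F\<^bsub>2m+1\<^esub>, F\<^bsub>2m+2\<^esub>)\<close>. These lie on one branch of
  the hyperbola \<open>(\<phi> x - y) (y + x/\<phi>) = 1\<close>, hence in convex position: the open half-plane beyond the
  tangent at one of them contains all the others. Intersecting the strip with these half-planes
  gives arbitrarily large families in which all proper subfamilies meet \<open>A\<^sup>2\<close> but the whole family
  does not.
\<close>

text \<open>The membership pattern makes \<open>C\<close> injective on \<open>{..h}\<close>, so the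
  family has \<open>h + 1\<close> members. A subfamily of at most \<open>h\<close> of them omits
  some \<open>C k\<close>, and \<open>v k\<close> then lies in all its members.\<close>

lemma not_helly_property:
  assumes "\<And>k. k \<le> h \<Longrightarrow> convex_vec d (C k)"
    and "\<And>k. k \<le> h \<Longrightarrow> v k \<in> S \<inter> carrier_vec d"
    and v_mem: "\<And>j k. j \<le> h \<Longrightarrow> k \<le> h \<Longrightarrow> v k \<in> C j \<longleftrightarrow> j \<noteq> k"
    and "(\<Inter>k\<le>h. C k) \<inter> S = {}"
  shows "\<not> helly_property d S h"
proof
  assume H: "helly_property d S h"
  let ?F = "C ` {..h}"
  have "inj_on C {..h}"
    by (rule inj_onI) (metis atMost_iff v_mem)
  then have card: "card ?F = Suc h"
    by (simp add: card_image)
  have "(carrier_vec d \<inter> \<Inter>G) \<inter> S \<noteq> {}" if G: "G \<subseteq> ?F" "card G \<le> h" for G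
  proof -
    have "G \<noteq> ?F"
      using that card by auto
    then obtain k where k: "k \<le> h" "C k \<notin> G"
      using G by auto
    have "v k \<in> X" if X: "X \<in> G" for X
    proof -
      obtain j where "j \<le> h" "X = C j"
        using X G by auto
      then show ?thesis
        using v_mem k X by auto
    qed
    then show ?thesis
      using assms(2)[OF k(1)] by blast
  qed
  moreover have "finite ?F" "\<forall>X\<in>?F. convex_vec d X"
    using assms(1) by auto
  ultimately have "(carrier_vec d \<inter> \<Inter>?F) \<inter> S \<noteq> {}"
    using H unfolding helly_property_def by blast
  then show False
    using assms(4) by blast
qed

lemma convex_vec_Int:
  "convex_vec d C \<Longrightarrow> convex_vec d D \<Longrightarrow> convex_vec d (C \<inter> D)"
  unfolding convex_vec_def by blast

lemma convex_vec_zero_coords: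
  "convex_vec d {p \<in> carrier_vec d. \<forall>i\<in>I. i < d \<longrightarrow> p $ i = 0}"
  unfolding convex_vec_def by auto

lemma convex_comb_gt:
  fixes s t c u v :: real
  assumes "s > c" "t > c" "u \<ge> 0" "v \<ge> 0" "u + v = 1"
  shows "u * s + v * t > c"
  using convex_bound_lt[of "-s" "-c" "-t" u v] assms by simp

lemma convex_comb_ge:
  fixes s t c u v :: real
  assumes "s \<ge> c" "t \<ge> c" "u \<ge> 0" "v \<ge> 0" "u + v = 1"
  shows "u * s + v * t \<ge> c"
  using convex_bound_le[of "-s" "-c" "-t" u v] assms by simp

lemma convex_vec_halfplane:
  assumes "d \<ge> 2"
  shows convex_vec_open_halfplane:
      "convex_vec d {p \<in> carrier_vec d. a * p $ 0 + b * p $ 1 > (c::real)}" (is "convex_vec d ?O")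
    and convex_vec_closed_halfplane:
      "convex_vec d {p \<in> carrier_vec d. a * p $ 0 + b * p $ 1 \<ge> c}" (is "convex_vec d ?C")
proof -
  let ?f = "\<lambda>p::real vec. a * p $ 0 + b * p $ 1"
  have f: "?f (u \<cdot>\<^sub>v p + v \<cdot>\<^sub>v q) = u * ?f p + v * ?f q"
    if "p \<in> carrier_vec d" "q \<in> carrier_vec d" for u v p q
    using that assms by (simp add: algebra_simps)
  have carrier: "u \<cdot>\<^sub>v p + v \<cdot>\<^sub>v q \<in> carrier_vec d"
    if "p \<in> carrier_vec d" "q \<in> carrier_vec d" for u v :: real and p q
    using that by simp
  show "convex_vec d ?O"
    unfolding convex_vec_def by (safe; simp only: f carrier convex_comb_gt)
  show "convex_vec d ?C"
    unfolding convex_vec_def by (safe; simp only: f carrier convex_comb_ge)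
qed

section \<open>The golden ratio and Fibonacci numbers\<close>

definition phi :: real where
  "phi = (1 + sqrt 5) / 2"

lemma phi_square: "phi * phi = phi + 1"
  by (simp add: phi_def field_simps)

lemma phi_square_mult: "phi * (phi * x) = phi * x + x"
  using phi_square by (metis distrib_right mult.assoc mult_1)

lemma phi_gt_1: "phi > 1"
  by (simp add: phi_def)

lemma phi_lt_2: "phi < 2"
proof -
  have "sqrt 5 < 3"
    by (rule real_less_lsqrt) auto
  then show ?thesis
    by (simp add: phi_def)
qed

lemma phi_inverse: "phi * (phi - 1) = 1"
  using phi_square by (simp add: algebra_simps)

lemma phi_power_inverse: "phi ^ n * (phi - 1) ^ n = 1"
  by (simp add: phi_inverse flip: power_mult_distrib)

text \<open>This linear form is an eigenvector of the Fibonacci recursion: each step multiplies it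
  by \<open>phi\<close>. The form in \<open>fib_phi_small\<close> belongs to the other eigenvalue,
  \<open>1 - phi\<close>.\<close>

lemma fib_phi_large: "real (fib (Suc n)) + (phi - 1) * real (fib n) = phi ^ n"
proof (induction n)
  case (Suc n)
  have "real (fib (Suc (Suc n))) + (phi - 1) * real (fib (Suc n))
      = phi * (real (fib (Suc n)) + (phi - 1) * real (fib n))"
    using phi_square_mult[of "real (fib n)"] by (simp add: algebra_simps)
  then show ?case
    using Suc by simp
qed simp

lemma fib_phi_small: "real (fib (Suc n)) - phi * real (fib n) = (1 - phi) ^ n"
proof (induction n)
  case (Suc n)
  have "real (fib (Suc (Suc n))) - phi * real (fib (Suc n))
      = (1 - phi) * (real (fib (Suc n)) - phi * real (fib n))"
    using phi_square_mult[of "real (fib n)"] by (simp add: algebra_simps)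
  then show ?case
    using Suc by simp
qed simp

text \<open>The odd exponent fixes the sign, which puts all these pairs on the same side of the line
  y = phi x. This is why only every second Fibonacci number is used.\<close>

lemma fib_phi_odd:
  "phi * real (fib (2 * m + 1)) - real (fib (2 * m + 2)) = (phi - 1) ^ (2 * m + 1)"
proof -
  have "(1 - phi) ^ (2 * m + 1) = - ((phi - 1) ^ (2 * m + 1))"
    using power_minus_odd[of "2 * m + 1" "phi - 1"] by simp
  then show ?thesis
    using fib_phi_small[of "2 * m + 1"] by simp
qed

lemma phi_odd_power_bounds:
  "0 < (phi - 1) ^ (2 * m + 1)" "(phi - 1) ^ (2 * m + 1) \<le> phi - 1"
  using phi_gt_1 phi_lt_2 by (simp_all add: mult_le_cancel_left1 power_le_one)

section \<open>The set, its gaps and its points in the strip\<close>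

definition golden_set :: "real set" where
  "golden_set = range (\<lambda>i::nat. - 2 * real i) \<union> range (\<lambda>i::nat. of_int \<lceil>phi * real i\<rceil>)
     \<union> range (\<lambda>m. real (fib (2 * m + 2)))"

lemma golden_set_Ints: "golden_set \<subseteq> \<int>"
  by (auto simp: golden_set_def)

lemma golden_set_next:
  assumes "a \<in> golden_set"
  obtains c where "c \<in> golden_set" "a < c" "c \<le> a + 2"
proof -
  obtain z where z: "a = of_int z"
    using assms golden_set_Ints by (auto elim: Ints_cases)
  show thesis
  proof (cases "z < 0")
    case True
    \<comment> \<open>The largest \<open>i\<close> with \<open>- 2 * i > z\<close>.\<close>
    define i where "i = nat ((- z - 1) div 2)"
    have "- 2 * real i = of_int (- 2 * ((- z - 1) div 2))"
      using True by (simp add: i_def)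
    moreover have "z < - 2 * ((- z - 1) div 2)" "- 2 * ((- z - 1) div 2) \<le> z + 2"
      by presburger+
    moreover have "- 2 * real i \<in> golden_set"
      by (auto simp: golden_set_def)
    ultimately show thesis
      by (metis that z of_int_less_iff of_int_le_iff of_int_add of_int_numeral)
  next
    case False
    \<comment> \<open>The least \<open>i\<close> with \<open>phi * i > a\<close>; the step of at
      most 2 then comes from \<open>phi < 2\<close>.\<close>
    define i where "i = nat (\<lfloor>a / phi\<rfloor> + 1)"
    have "a / phi \<ge> 0"
      using False z phi_gt_1 by simp
    then have "real i = of_int \<lfloor>a / phi\<rfloor> + 1"
      by (simp add: i_def)
    then have "a / phi < real i" "real i \<le> a / phi + 1"
      by linarith+
    then have i: "a < phi * real i" "phi * real i \<le> a + phi"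
      using phi_gt_1 by (simp_all add: field_simps)
    have "z < \<lceil>phi * real i\<rceil>" "\<lceil>phi * real i\<rceil> \<le> z + 2"
      using i z phi_lt_2 by (simp_all add: less_ceiling_iff ceiling_le_iff)
    then have "a < of_int \<lceil>phi * real i\<rceil>" "of_int \<lceil>phi * real i\<rceil> \<le> a + 2"
      using z by linarith+
    then show thesis
      by (intro that[of "of_int \<lceil>phi * real i\<rceil>"]) (auto simp: golden_set_def)
  qed
qed

lemma golden_set_strip:
  assumes "p \<in> golden_set" "q \<in> golden_set" "q > 0"
    and "- phi / 2 * p - q > 0" "- phi / 2 * p - q \<le> phi - 1"
  obtains m where "p = - 2 * real (fib (2 * m + 1))" "q = real (fib (2 * m + 2))"
proof -
  have "phi * p < 0"
    using assms(3,4) by simp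
  then have "p < 0"
    using phi_gt_1 by (simp add: mult_less_0_iff)
  obtain i where i: "p = - 2 * real i"
  proof -
    consider i where "p = - 2 * real i" | j where "p = of_int \<lceil>phi * real j\<rceil>" | "p \<ge> 0"
      using assms(1) by (auto simp: golden_set_def)
    then show thesis
    proof cases
      case (2 j)
      have "phi * real j \<ge> 0"
        using phi_gt_1 by simp
      then show thesis
        using 2 \<open>p < 0\<close> by linarith
    qed (use that \<open>p < 0\<close> in auto)
  qed
  have q: "q < phi * real i" "phi * real i - q \<le> phi - 1"
    using assms(4,5) i by simp_all
  consider j where "q = of_int \<lceil>phi * real j\<rceil>" | m where "q = real (fib (2 * m + 2))"
    using assms(2,3) by (auto simp: golden_set_def)
  then show thesis
  proof cases
    case 1
    \<comment> \<open>Here \<open>i > j\<close>, so \<open>phi * i - q\<close> is at least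
      \<open>phi * (j + 1) - q\<close>, which exceeds \<open>phi - 1\<close> because the ceiling
      \<open>q\<close> is below \<open>phi * j + 1\<close>.\<close>
    have "phi * real j < phi * real i"
      using q(1) 1 by linarith
    then have "j + 1 \<le> i"
      using phi_gt_1 by simp
    then have "phi * (real j + 1) \<le> phi * real i"
      using phi_gt_1 by (intro mult_left_mono) linarith+
    moreover have "q < phi * real j + 1"
      using 1 by linarith
    ultimately have False
      using q(2) by (simp add: algebra_simps)
    then show thesis ..
  next
    case 2
    let ?j = "fib (2 * m + 1)"
    have j: "q < phi * real ?j" "phi * real ?j - q \<le> phi - 1"
      using fib_phi_odd[of m] phi_odd_power_bounds[of m] 2 by simp_all
    \<comment> \<open>The strip is narrower than \<open>phi\<close>, so each \<open>q\<close> admits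
      at most one index; applying this both ways gives \<open>i = ?j\<close>.\<close>
    have le: "b \<le> a"
      if "phi * real b - q \<le> phi - 1" "q < phi * real a" for a b :: nat
    proof (rule ccontr)
      assume "\<not> b \<le> a"
      then have "phi * (real a + 1) \<le> phi * real b"
        using phi_gt_1 by (intro mult_left_mono) linarith+
      then show False
        using that by (simp add: algebra_simps)
    qed
    have "i = ?j"
      using le q j by (meson antisym)
    then show thesis
      using that i 2 by blast
  qed
qed

section \<open>Golden points and the cells that separate them\<close>

definition golden_point :: "nat \<Rightarrow> nat \<Rightarrow> real vec" where
  "golden_point d m = vec d (\<lambda>i. if i = 0 then - 2 * real (fib (2 * m + 1))
     else if i = 1 then real (fib (2 * m + 2)) else 0)"

text \<open>
  With \<open>r = - \<phi> p\<^sub>0/2 - p\<^sub>1\<close> and \<open>t = p\<^sub>1 - (\<phi> - 1) p\<^sub>0/2\<close>, the golden points satisfy \<open>t = \<phi>\<^bsup>2m+1\<^esup>\<close>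
  and \<open>r = 1/t\<close>. The conditions below are \<open>p\<^sub>1 > 0\<close>, \<open>r > 0\<close>, \<open>r \<le> \<phi> - 1\<close>, \<open>t \<le> \<phi>\<^bsup>2h+1\<^esup>\<close> and that
  \<open>p\<close> lies strictly beyond the tangent of \<open>r t = 1\<close> at the \<open>k\<close>-th golden point.
\<close>

definition golden_cell :: "nat \<Rightarrow> nat \<Rightarrow> nat \<Rightarrow> real vec set" where
  "golden_cell d h k =
     {p \<in> carrier_vec d. \<forall>i\<in>{2..}. i < d \<longrightarrow> p $ i = 0} \<inter>
     {p \<in> carrier_vec d. 0 * p $ 0 + 1 * p $ 1 > 0} \<inter>
     {p \<in> carrier_vec d. - phi / 2 * p $ 0 + - 1 * p $ 1 > 0} \<inter>
     {p \<in> carrier_vec d. phi / 2 * p $ 0 + 1 * p $ 1 \<ge> 1 - phi} \<inter>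
     {p \<in> carrier_vec d. (phi - 1) / 2 * p $ 0 + - 1 * p $ 1 \<ge> - (phi ^ (2 * h + 1))} \<inter>
     {p \<in> carrier_vec d.
        (- ((phi - 1) ^ (2 * k + 1) * (phi - 1) / 2) - phi ^ (2 * k + 1) * phi / 2) * p $ 0
        + ((phi - 1) ^ (2 * k + 1) - phi ^ (2 * k + 1)) * p $ 1 > 2}"

text \<open>The definition lists coefficients of the coordinates to fit the half-plane lemmas;
  regrouping them recovers the conditions on \<open>r\<close> and \<open>t\<close>.\<close>

lemma golden_cell_iff:
  "p \<in> golden_cell d h k \<longleftrightarrow>
     p \<in> carrier_vec d \<and> (\<forall>i\<in>{2..}. i < d \<longrightarrow> p $ i = 0) \<and> p $ 1 > 0 \<and>
     - phi / 2 * p $ 0 - p $ 1 > 0 \<and> - phi / 2 * p $ 0 - p $ 1 \<le> phi - 1 \<and>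
     p $ 1 - (phi - 1) / 2 * p $ 0 \<le> phi ^ (2 * h + 1) \<and>
     (phi - 1) ^ (2 * k + 1) * (p $ 1 - (phi - 1) / 2 * p $ 0)
       + phi ^ (2 * k + 1) * (- phi / 2 * p $ 0 - p $ 1) > 2"
proof -
  have "(- (X * (phi - 1) / 2) - Y * phi / 2) * x + (X - Y) * y
      = X * (y - (phi - 1) / 2 * x) + Y * (- phi / 2 * x - y)" for X Y x y
    by (simp add: field_simps)
  then show ?thesis
    unfolding golden_cell_def Int_iff mem_Collect_eq by auto
qed

lemma convex_golden_cell: "d \<ge> 2 \<Longrightarrow> convex_vec d (golden_cell d h k)"
  unfolding golden_cell_def
  by (intro convex_vec_Int convex_vec_zero_coords convex_vec_open_halfplane
      convex_vec_closed_halfplane)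

text \<open>At the \<open>m\<close>-th point the tangent condition reads
  \<open>T m / T k + T k / T m > 2\<close>, which is AM-GM, strict exactly when \<open>T k\<close>
  and \<open>T m\<close> differ.\<close>

lemma golden_point_in_golden_cell:
  assumes "d \<ge> 2" "m \<le> h"
  shows "golden_point d m \<in> golden_cell d h k \<longleftrightarrow> k \<noteq> m"
proof -
  let ?p = "golden_point d m"
  define T where "T j = phi ^ (2 * j + 1)" for j :: nat
  have T_pos: "T j > 0" for j
    using phi_gt_1 by (simp add: T_def)
  have inv: "(phi - 1) ^ (2 * j + 1) = 1 / T j" for j
    using phi_power_inverse[of "2 * j + 1"] T_pos[of j]
    unfolding T_def by (metis eq_divide_imp less_irrefl mult.commute)
  have p: "?p $ 0 = - 2 * real (fib (2 * m + 1))" "?p $ 1 = real (fib (2 * m + 2))"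
    using assms by (simp_all add: golden_point_def)
  have r: "- phi / 2 * ?p $ 0 - ?p $ 1 = 1 / T m"
    unfolding p using fib_phi_odd[of m] inv[of m] by simp
  have t: "?p $ 1 - (phi - 1) / 2 * ?p $ 0 = T m"
    unfolding p T_def using fib_phi_large[of "2 * m + 1"] by simp
  have "T m \<le> T h"
    unfolding T_def using assms phi_gt_1 by (intro power_increasing) auto
  moreover have "1 / T m > 0" "1 / T m \<le> phi - 1"
    using phi_odd_power_bounds[of m] inv[of m] by simp_all
  moreover have "?p \<in> carrier_vec d" "\<forall>i\<in>{2..}. i < d \<longrightarrow> ?p $ i = 0"
    by (auto simp: golden_point_def)
  moreover have "?p $ 1 > 0"
    unfolding p by (simp only: of_nat_0_less_iff fib_neq_0_nat)
  moreover have "1 / T k * T m + T k * (1 / T m) > 2 \<longleftrightarrow> k \<noteq> m"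
  proof -
    have "T k * T m > 0"
      using T_pos by simp
    moreover have "1 / T k * T m + T k * (1 / T m) - 2 = (T k - T m)\<^sup>2 / (T k * T m)"
      using T_pos[of k] T_pos[of m] by (simp add: field_simps power2_eq_square)
    ultimately have "1 / T k * T m + T k * (1 / T m) - 2 > 0 \<longleftrightarrow> T k \<noteq> T m"
      by (simp add: zero_less_divide_iff)
    also have "T k \<noteq> T m \<longleftrightarrow> k \<noteq> m"
      using phi_gt_1 unfolding T_def by (subst power_inject_exp) auto
    finally show ?thesis
      by simp
  qed
  ultimately show ?thesis
    unfolding golden_cell_iff inv r t T_def[symmetric] by blast
qed

lemma golden_point_in_cart_power: "golden_point d m \<in> cart_power golden_set d"
proof -
  have "0 \<in> golden_set"
    by (auto simp: golden_set_def intro!: image_eqI[of _ _ 0])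
  then show ?thesis
    by (auto simp: cart_power_def golden_point_def golden_set_def simp del: fib.simps)
qed

lemma golden_cells_Inter:
  assumes "d \<ge> 2"
  shows "(\<Inter>k\<le>h. golden_cell d h k) \<inter> cart_power golden_set d = {}"
proof (rule ccontr)
  assume "\<not> ?thesis"
  then obtain p where p: "\<And>k. k \<le> h \<Longrightarrow> p \<in> golden_cell d h k"
    and A: "p \<in> cart_power golden_set d"
    by auto
  \<comment> \<open>All conditions except the tangent one are common to the cells, so a single cell
    already forces \<open>p\<close> to be a golden point.\<close>
  have p0: "p \<in> golden_cell d h 0"
    by (rule p) simp
  have "p $ 0 \<in> golden_set" "p $ 1 \<in> golden_set"
    using A assms by (auto simp: cart_power_def)
  then obtain m where m: "p $ 0 = - 2 * real (fib (2 * m + 1))" "p $ 1 = real (fib (2 * m + 2))"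
    using p0 unfolding golden_cell_iff by (blast elim: golden_set_strip)
  have "p = golden_point d m"
  proof (rule eq_vecI)
    fix i assume "i < dim_vec (golden_point d m)"
    moreover have "i = 0 \<or> i = 1 \<or> i \<in> {2..}"
      by auto
    ultimately show "p $ i = golden_point d m $ i"
      using m p0 unfolding golden_cell_iff by (auto simp: golden_point_def)
  qed (use p0 in \<open>auto simp: golden_cell_iff golden_point_def\<close>)
  \<comment> \<open>The bound on \<open>t\<close> cuts off later golden points, so the cell that
    excludes \<open>p\<close> is among those intersected.\<close>
  moreover have "m \<le> h"
  proof -
    have "p $ 1 - (phi - 1) / 2 * p $ 0 = phi ^ (2 * m + 1)"
      unfolding m using fib_phi_large[of "2 * m + 1"] by simp
    then have "phi ^ (2 * m + 1) \<le> phi ^ (2 * h + 1)"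
      using p0 unfolding golden_cell_iff by simp
    then show ?thesis
      using phi_gt_1 by (subst (asm) power_increasing_iff) auto
  qed
  ultimately show False
    using golden_point_in_golden_cell[OF assms, of m h m] p by blast
qed

theorem theorem1p8:
  shows "\<exists>A :: real set. A \<subseteq> \<int> \<and>
           (\<forall>a\<in>A. \<forall>b\<in>A. a < b \<and> A \<inter> {a<..<b} = {} \<longrightarrow> b - a \<le> 2) \<and>
           (\<forall>d\<ge>2. helly_number d (cart_power A d) = \<infinity>)"
proof (intro exI[of _ golden_set] conjI ballI allI impI)
  show "golden_set \<subseteq> \<int>"
    by (rule golden_set_Ints)
next
  fix a b assume "a \<in> golden_set" and ab: "a < b \<and> golden_set \<inter> {a<..<b} = {}"
  then obtain c where "c \<in> golden_set" "a < c" "c \<le> a + 2"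
    by (blast elim: golden_set_next)
  moreover from this ab have "b \<le> c"
    by (metis Int_iff empty_iff greaterThanLessThan_iff not_le)
  ultimately show "b - a \<le> 2"
    by simp
next
  fix d :: nat assume d: "d \<ge> 2"
  have "\<not> helly_property d (cart_power golden_set d) h" for h
  proof (rule not_helly_property[where C = "golden_cell d h" and v = "golden_point d"])
    show "golden_point d k \<in> cart_power golden_set d \<inter> carrier_vec d" for k
      using golden_point_in_cart_power by (auto simp: golden_point_def)
  qed (use d convex_golden_cell golden_point_in_golden_cell golden_cells_Inter in auto)
  then show "helly_number d (cart_power golden_set d) = \<infinity>"
    by (simp add: helly_number_def)
qed

end
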